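(* Let $G=(V,E)$ be a finite directed graph, let $\varepsilon\in(0,1)$, and let $K\subseteq V$ be coherent. Then there exists a reset vector $r$ on $G$ such that $R_{\min}(G,K,\varepsilon)=\mathrm{PR}(G,r,\varepsilon)$.
   Context: Every vertex of a graph with no out-edges is assumed to carry a self-loop; $d_{out}(u)$ is the out-degree of $u$. A ranking vector (or reset vector) on $G$ is a function $x:V\to[0,1]$ with $\sum_{v}x[v]=1$. For a reset vector $r$ and $\varepsilon\in(0,1)$, $\mathrm{PR}(G,r,\varepsilon)$ is the unique stationary distribution of the Markov chain on $V$ with transition matrix $(1-\varepsilon)M+\varepsilon R$, where $M[u,v]=1/d_{out}(u)$ if $(u,v)\in E$ and $0$ otherwise, and $R[u,v]=r[v]$. For $c\in V$, $\mathrm{PR}(G,c,\varepsilon)$ denotes this with $r$ the point mass at $c$. A set $K\subseteq V$ is coherent if it is non-empty and there is a vertex $v\in V$ such that every vertex of $K$ has a directed path to $v$. For coherent $K$, $R_{\min}(G,K,\varepsilon)$ is the vector $y/\|y\|_1$ where $y[v]=\min\{\mathrm{PR}(G,c,\varepsilon)[v]: c\in K\}$ (coherence guarantees $y\neq 0$). *)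

theory Defs
  imports Complex_Main "HOL-Library.FuncSet" "Graph_Theory.Pair_Digraph"
begin

text \<open>Vectors indexed by the vertex set \<open>V\<close> are extensional functions on \<open>V\<close>, so that HOL
  equality of two vectors is equality on \<open>V\<close>.\<close>

definition distribution_on :: "'a set \<Rightarrow> ('a \<Rightarrow> real) \<Rightarrow> bool" where
  "distribution_on V x \<longleftrightarrow> x \<in> V \<rightarrow>\<^sub>E {0..1} \<and> (\<Sum>v\<in>V. x v) = 1"

definition stationary_distribution :: "'a set \<Rightarrow> ('a \<Rightarrow> 'a \<Rightarrow> real) \<Rightarrow> ('a \<Rightarrow> real) \<Rightarrow> bool" where
  "stationary_distribution V P x \<longleftrightarrow>
     distribution_on V x \<and> (\<forall>v\<in>V. (\<Sum>u\<in>V. x u * P u v) = x v)"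

abbreviation ranking_vector :: "'a pair_pre_digraph \<Rightarrow> ('a \<Rightarrow> real) \<Rightarrow> bool" where
  "ranking_vector G x \<equiv> distribution_on (pverts G) x"

definition walk_matrix :: "'a pair_pre_digraph \<Rightarrow> 'a \<Rightarrow> 'a \<Rightarrow> real" where
  "walk_matrix G u v = (if (u, v) \<in> parcs G then 1 / real (out_degree (with_proj G) u) else 0)"

definition reset_matrix :: "('a \<Rightarrow> real) \<Rightarrow> 'a \<Rightarrow> 'a \<Rightarrow> real" where
  "reset_matrix r u v = r v"

definition PR :: "'a pair_pre_digraph \<Rightarrow> ('a \<Rightarrow> real) \<Rightarrow> real \<Rightarrow> 'a \<Rightarrow> real" where
  "PR G r \<epsilon> = (THE x. stationary_distribution (pverts G)
     (\<lambda>u v. (1 - \<epsilon>) * walk_matrix G u v + \<epsilon> * reset_matrix r u v) x)"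

definition point_mass :: "'a pair_pre_digraph \<Rightarrow> 'a \<Rightarrow> 'a \<Rightarrow> real" where
  "point_mass G c = (\<lambda>v\<in>pverts G. if v = c then 1 else 0)"

definition coherent :: "'a pair_pre_digraph \<Rightarrow> 'a set \<Rightarrow> bool" where
  "coherent G K \<longleftrightarrow> K \<noteq> {} \<and> K \<subseteq> pverts G \<and>
     (\<exists>v\<in>pverts G. \<forall>u\<in>K. reachable (with_proj G) u v)"

definition R_min :: "'a pair_pre_digraph \<Rightarrow> 'a set \<Rightarrow> real \<Rightarrow> 'a \<Rightarrow> real" where
  "R_min G K \<epsilon> =
     (let y = (\<lambda>v. Min ((\<lambda>c. PR G (point_mass G c) \<epsilon> v) ` K))
      in (\<lambda>v\<in>pverts G. y v / (\<Sum>w\<in>pverts G. \<bar>y w\<bar>)))"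

end

theory Submission
  imports Defs
begin

text \<open>
  A probability vector \<open>x\<close> is \<open>PR G r \<epsilon>\<close> iff \<open>x = (1 - \<epsilon>) x M + \<epsilon> r\<close>; a solution is the
  Neumann series \<open>\<Sum>k. \<epsilon> (1 - \<epsilon>)\<^sup>k r M\<^sup>k\<close>, and it is unique because \<open>x \<mapsto> (1 - \<epsilon>) x M\<close>
  contracts the 1-norm. Solving for \<open>r\<close> shows that \<open>x\<close> is a PageRank vector for some reset
  vector iff it is excessive, i.e. \<open>(1 - \<epsilon>) x M \<le> x\<close> pointwise. Excessive vectors are closed
  under pointwise minima and positive scaling, and coherence makes the minimum over \<open>K\<close> nonzero.
\<close>

section \<open>Probability vectors\<close>

lemma distribution_on_iff:
  assumes "finite V"
  shows "distribution_on V x \<longleftrightarrow>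
    x \<in> extensional V \<and> (\<forall>v\<in>V. 0 \<le> x v) \<and> (\<Sum>v\<in>V. x v) = 1"
proof -
  have "x v \<le> 1" if "\<forall>v\<in>V. 0 \<le> x v" "(\<Sum>v\<in>V. x v) = 1" "v \<in> V" for v
    using member_le_sum[of v V x] that assms by auto
  then show ?thesis
    by (auto simp: distribution_on_def PiE_def)
qed

definition normalize_on :: "'a set \<Rightarrow> ('a \<Rightarrow> real) \<Rightarrow> 'a \<Rightarrow> real" where
  "normalize_on V x = (\<lambda>v\<in>V. x v / (\<Sum>w\<in>V. \<bar>x w\<bar>))"

lemma distribution_on_normalize_on:
  assumes "finite V" and nonneg: "\<And>v. v \<in> V \<Longrightarrow> 0 \<le> x v" and "t \<in> V" "0 < x t"
  shows "distribution_on V (normalize_on V x)"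
proof -
  have "0 < (\<Sum>v\<in>V. x v)"
    using assms by (intro sum_pos2[of V t]) auto
  then show ?thesis
    using assms(1) nonneg
    by (simp add: distribution_on_iff normalize_on_def sum_divide_distrib[symmetric])
qed

section \<open>Stochastic matrices\<close>

definition teleport_matrix :: "('a \<Rightarrow> 'a \<Rightarrow> real) \<Rightarrow> ('a \<Rightarrow> real) \<Rightarrow> real \<Rightarrow> 'a \<Rightarrow> 'a \<Rightarrow> real" where
  "teleport_matrix M r \<epsilon> = (\<lambda>u v. (1 - \<epsilon>) * M u v + \<epsilon> * reset_matrix r u v)"

locale stochastic_matrix =
  fixes V :: "'a set" and M :: "'a \<Rightarrow> 'a \<Rightarrow> real"
  assumes finite_index: "finite V"
    and entry_nonneg: "\<And>u v. u \<in> V \<Longrightarrow> v \<in> V \<Longrightarrow> 0 \<le> M u v"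
    and row_sum: "\<And>u. u \<in> V \<Longrightarrow> (\<Sum>v\<in>V. M u v) = 1"
begin

definition vector_mult :: "('a \<Rightarrow> real) \<Rightarrow> 'a \<Rightarrow> real" where
  "vector_mult x v = (\<Sum>u\<in>V. x u * M u v)"

lemma vector_mult_mono:
  assumes "\<And>u. u \<in> V \<Longrightarrow> x u \<le> y u" "v \<in> V"
  shows "vector_mult x v \<le> vector_mult y v"
  unfolding vector_mult_def using assms by (intro sum_mono mult_right_mono entry_nonneg)

lemma vector_mult_ge_entry:
  assumes "\<And>u. u \<in> V \<Longrightarrow> 0 \<le> x u" "u \<in> V" "v \<in> V"
  shows "x u * M u v \<le> vector_mult x v"
  unfolding vector_mult_def using assms finite_index
  by (intro member_le_sum) (auto intro!: mult_nonneg_nonneg entry_nonneg)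

lemma vector_mult_nonneg:
  assumes "\<And>u. u \<in> V \<Longrightarrow> 0 \<le> x u" "v \<in> V"
  shows "0 \<le> vector_mult x v"
  unfolding vector_mult_def using assms by (intro sum_nonneg mult_nonneg_nonneg entry_nonneg)

lemma vector_mult_cong:
  assumes "\<And>u. u \<in> V \<Longrightarrow> x u = y u"
  shows "vector_mult x v = vector_mult y v"
  unfolding vector_mult_def using assms by simp

lemma vector_mult_diff: "vector_mult (\<lambda>u. x u - y u) v = vector_mult x v - vector_mult y v"
  by (simp add: vector_mult_def left_diff_distrib sum_subtractf)

lemma vector_mult_divide: "vector_mult (\<lambda>u. x u / c) v = vector_mult x v / c"
  by (simp add: vector_mult_def sum_divide_distrib)

lemma sum_vector_mult: "(\<Sum>v\<in>V. vector_mult x v) = (\<Sum>u\<in>V. x u)"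
proof -
  have "(\<Sum>v\<in>V. vector_mult x v) = (\<Sum>u\<in>V. x u * (\<Sum>v\<in>V. M u v))"
    unfolding vector_mult_def by (subst sum.swap) (simp add: sum_distrib_left)
  then show ?thesis
    by (simp add: row_sum)
qed

lemma sum_abs_vector_mult_le: "(\<Sum>v\<in>V. \<bar>vector_mult x v\<bar>) \<le> (\<Sum>u\<in>V. \<bar>x u\<bar>)"
proof -
  have "\<bar>vector_mult x v\<bar> \<le> vector_mult (\<lambda>u. \<bar>x u\<bar>) v" if "v \<in> V" for v
  proof -
    have "\<bar>vector_mult x v\<bar> \<le> (\<Sum>u\<in>V. \<bar>x u * M u v\<bar>)"
      unfolding vector_mult_def by (rule sum_abs)
    also have "\<dots> = vector_mult (\<lambda>u. \<bar>x u\<bar>) v"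
      using that by (simp add: vector_mult_def abs_mult entry_nonneg)
    finally show ?thesis .
  qed
  then have "(\<Sum>v\<in>V. \<bar>vector_mult x v\<bar>) \<le> (\<Sum>v\<in>V. vector_mult (\<lambda>u. \<bar>x u\<bar>) v)"
    by (rule sum_mono)
  then show ?thesis
    by (simp add: sum_vector_mult)
qed

subsection \<open>The equation \<open>x = a x M + b\<close>\<close>

definition discounted_fixpoint :: "real \<Rightarrow> ('a \<Rightarrow> real) \<Rightarrow> ('a \<Rightarrow> real) \<Rightarrow> bool" where
  "discounted_fixpoint a b x \<longleftrightarrow> (\<forall>v\<in>V. x v = a * vector_mult x v + b v)"

lemma discounted_fixpoint_cong:
  assumes "\<And>v. v \<in> V \<Longrightarrow> x v = y v"
  shows "discounted_fixpoint a b x \<longleftrightarrow> discounted_fixpoint a b y"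
  using assms vector_mult_cong[OF assms] by (simp add: discounted_fixpoint_def)

lemma discounted_fixpoint_sum:
  assumes "discounted_fixpoint a b x"
  shows "(1 - a) * (\<Sum>v\<in>V. x v) = (\<Sum>v\<in>V. b v)"
proof -
  have "(\<Sum>v\<in>V. x v) = (\<Sum>v\<in>V. a * vector_mult x v + b v)"
    using assms by (auto simp: discounted_fixpoint_def intro: sum.cong)
  also have "\<dots> = a * (\<Sum>v\<in>V. x v) + (\<Sum>v\<in>V. b v)"
    by (simp add: sum.distrib sum_distrib_left[symmetric] sum_vector_mult)
  finally show ?thesis
    by (subst left_diff_distrib) linarith
qed

lemma discounted_fixpoint_unique:
  assumes "\<bar>a\<bar> < 1" and "discounted_fixpoint a b x" "discounted_fixpoint a b y" and "v \<in> V"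
  shows "x v = y v"
proof -
  define d where "d = (\<lambda>v. x v - y v)"
  have "d v = a * vector_mult d v" if "v \<in> V" for v
    using assms(2,3) that
    by (simp add: d_def discounted_fixpoint_def vector_mult_diff right_diff_distrib)
  then have "(\<Sum>v\<in>V. \<bar>d v\<bar>) = (\<Sum>v\<in>V. \<bar>a * vector_mult d v\<bar>)"
    by (metis (mono_tags, lifting) sum.cong)
  also have "\<dots> = \<bar>a\<bar> * (\<Sum>v\<in>V. \<bar>vector_mult d v\<bar>)"
    by (simp add: abs_mult sum_distrib_left)
  also have "\<dots> \<le> \<bar>a\<bar> * (\<Sum>v\<in>V. \<bar>d v\<bar>)"
    by (intro mult_left_mono sum_abs_vector_mult_le) simp
  finally have "(1 - \<bar>a\<bar>) * (\<Sum>v\<in>V. \<bar>d v\<bar>) \<le> 0"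
    by (simp add: left_diff_distrib)
  then have "(\<Sum>v\<in>V. \<bar>d v\<bar>) \<le> 0"
    using assms(1) by (simp add: mult_le_0_iff)
  then have "(\<Sum>v\<in>V. \<bar>d v\<bar>) = 0"
    by (simp add: antisym sum_nonneg)
  then show ?thesis
    using \<open>v \<in> V\<close> finite_index by (simp add: sum_nonneg_eq_0_iff d_def)
qed

definition resolvent :: "real \<Rightarrow> ('a \<Rightarrow> real) \<Rightarrow> 'a \<Rightarrow> real" where
  "resolvent a b v = (\<Sum>k. a ^ k * (vector_mult ^^ k) b v)"

lemma abs_vector_mult_funpow_le:
  assumes "v \<in> V"
  shows "\<bar>(vector_mult ^^ k) b v\<bar> \<le> (\<Sum>u\<in>V. \<bar>b u\<bar>)"
proof -
  have "(\<Sum>u\<in>V. \<bar>(vector_mult ^^ k) b u\<bar>) \<le> (\<Sum>u\<in>V. \<bar>b u\<bar>)"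
    by (induction k) (auto intro: order_trans[OF sum_abs_vector_mult_le])
  moreover have "\<bar>(vector_mult ^^ k) b v\<bar> \<le> (\<Sum>u\<in>V. \<bar>(vector_mult ^^ k) b u\<bar>)"
    using assms finite_index by (intro member_le_sum) auto
  ultimately show ?thesis
    by linarith
qed

lemma vector_mult_funpow_nonneg:
  assumes "\<And>v. v \<in> V \<Longrightarrow> 0 \<le> b v" "v \<in> V"
  shows "0 \<le> (vector_mult ^^ k) b v"
  using assms(2) by (induction k arbitrary: v) (auto intro: assms(1) vector_mult_nonneg)

lemma resolvent_sums:
  assumes "\<bar>a\<bar> < 1" "v \<in> V"
  shows "(\<lambda>k. a ^ k * (vector_mult ^^ k) b v) sums resolvent a b v"
proof -
  define B where "B = (\<Sum>u\<in>V. \<bar>b u\<bar>)"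
  have "summable (\<lambda>k. \<bar>a\<bar> ^ k * B)"
    using assms(1) by (intro summable_mult2 summable_geometric) simp
  moreover have "norm (a ^ k * (vector_mult ^^ k) b v) \<le> \<bar>a\<bar> ^ k * B" for k
    using abs_vector_mult_funpow_le[OF assms(2)]
    by (auto simp: B_def abs_mult power_abs intro: mult_left_mono)
  ultimately have "summable (\<lambda>k. a ^ k * (vector_mult ^^ k) b v)"
    by (rule summable_comparison_test')
  then show ?thesis
    unfolding resolvent_def by (rule summable_sums)
qed

lemma resolvent_nonneg:
  assumes "0 \<le> a" "a < 1" "\<And>v. v \<in> V \<Longrightarrow> 0 \<le> b v" "v \<in> V"
  shows "0 \<le> resolvent a b v"
proof (rule sums_le)
  show "(\<lambda>_. 0) sums (0 :: real)"
    by simp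
  show "(\<lambda>k. a ^ k * (vector_mult ^^ k) b v) sums resolvent a b v"
    using assms by (intro resolvent_sums) auto
  show "0 \<le> a ^ k * (vector_mult ^^ k) b v" for k
    using assms by (intro mult_nonneg_nonneg zero_le_power vector_mult_funpow_nonneg)
qed

lemma discounted_fixpoint_resolvent:
  assumes "\<bar>a\<bar> < 1"
  shows "discounted_fixpoint a b (resolvent a b)"
  unfolding discounted_fixpoint_def
proof
  fix v assume "v \<in> V"
  let ?term = "\<lambda>k v. a ^ k * (vector_mult ^^ k) b v"
  have "(\<lambda>k. a * vector_mult (?term k) v) sums (a * vector_mult (resolvent a b) v)"
    unfolding vector_mult_def[of "?term _"] vector_mult_def[of "resolvent a b"]
    using assms by (intro sums_mult sums_sum sums_mult2 resolvent_sums)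
  moreover have "a * vector_mult (?term k) v = ?term (Suc k) v" for k
    by (simp add: vector_mult_def sum_distrib_left mult_ac)
  ultimately have "(\<lambda>k. ?term k v) sums (a * vector_mult (resolvent a b) v + ?term 0 v)"
    by (intro sums_Suc) simp
  then show "resolvent a b v = a * vector_mult (resolvent a b) v + b v"
    using resolvent_sums[OF assms \<open>v \<in> V\<close>, of b] by (simp add: sums_unique2)
qed

subsection \<open>Stationary distributions of the chain with teleportation\<close>

lemma stationary_teleport_iff:
  "stationary_distribution V (teleport_matrix M r \<epsilon>) x \<longleftrightarrow>
    distribution_on V x \<and> discounted_fixpoint (1 - \<epsilon>) (\<lambda>v. \<epsilon> * r v) x"
proof -
  have "(\<Sum>u\<in>V. x u * teleport_matrix M r \<epsilon> u v) =
      (1 - \<epsilon>) * vector_mult x v + (\<Sum>u\<in>V. x u) * (\<epsilon> * r v)" for v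
    by (simp add: teleport_matrix_def reset_matrix_def vector_mult_def distrib_left sum.distrib
        sum_distrib_left sum_distrib_right mult.left_commute)
  then show ?thesis
    by (auto simp: stationary_distribution_def discounted_fixpoint_def distribution_on_def)
qed

lemma ex_stationary_teleport:
  assumes "0 < \<epsilon>" "\<epsilon> \<le> 1" "distribution_on V r"
  shows "\<exists>x. stationary_distribution V (teleport_matrix M r \<epsilon>) x"
proof -
  define b where "b = (\<lambda>v. \<epsilon> * r v)"
  define x where "x = restrict (resolvent (1 - \<epsilon>) b) V"
  have r_nonneg: "\<And>v. v \<in> V \<Longrightarrow> 0 \<le> r v" and r_sum: "(\<Sum>v\<in>V. r v) = 1"
    using assms(3) by (auto simp: distribution_on_iff finite_index)
  have fixpoint: "discounted_fixpoint (1 - \<epsilon>) b x"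
    using discounted_fixpoint_resolvent[of "1 - \<epsilon>" b] assms(1,2)
    by (simp add: x_def cong: discounted_fixpoint_cong)
  have "(\<Sum>v\<in>V. x v) = 1"
    using discounted_fixpoint_sum[OF fixpoint] r_sum assms(1)
    by (simp add: b_def sum_distrib_left[symmetric])
  moreover have "0 \<le> x v" if "v \<in> V" for v
    using that r_nonneg assms(1,2) by (simp add: x_def b_def resolvent_nonneg)
  ultimately have "distribution_on V x"
    by (simp add: distribution_on_iff finite_index x_def)
  with fixpoint show ?thesis
    by (auto simp: stationary_teleport_iff b_def)
qed

lemma stationary_teleport_unique:
  assumes "0 < \<epsilon>" "\<epsilon> \<le> 1"
    and "stationary_distribution V (teleport_matrix M r \<epsilon>) x"
    and "stationary_distribution V (teleport_matrix M r \<epsilon>) y"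
  shows "x = y"
proof (rule extensionalityI)
  show "x \<in> extensional V" "y \<in> extensional V"
    using assms(3,4) by (simp_all add: stationary_teleport_iff distribution_on_iff finite_index)
  show "x v = y v" if "v \<in> V" for v
    using assms that discounted_fixpoint_unique[of "1 - \<epsilon>" "\<lambda>v. \<epsilon> * r v" x y v]
    by (simp add: stationary_teleport_iff)
qed

subsection \<open>Excessive vectors\<close>

definition excessive :: "real \<Rightarrow> ('a \<Rightarrow> real) \<Rightarrow> bool" where
  "excessive a x \<longleftrightarrow> (\<forall>v\<in>V. 0 \<le> x v \<and> a * vector_mult x v \<le> x v)"

lemma excessive_nonneg: "excessive a x \<Longrightarrow> v \<in> V \<Longrightarrow> 0 \<le> x v"
  by (simp add: excessive_def)

lemma excessive_Min:
  assumes "0 \<le> a" "finite I" "I \<noteq> {}" and exc: "\<And>i. i \<in> I \<Longrightarrow> excessive a (x i)"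
  shows "excessive a (\<lambda>v. Min ((\<lambda>i. x i v) ` I))"
  unfolding excessive_def
proof (intro ballI conjI)
  fix v assume v: "v \<in> V"
  let ?y = "\<lambda>v. Min ((\<lambda>i. x i v) ` I)"
  have "?y v \<in> (\<lambda>i. x i v) ` I"
    using assms(2,3) by (intro Min_in) auto
  then obtain i where i: "i \<in> I" "?y v = x i v"
    by blast
  show "0 \<le> ?y v"
    using exc[OF i(1)] i(2) v by (simp add: excessive_def)
  have "a * vector_mult ?y v \<le> a * vector_mult (x i) v"
    using i(1) v assms(1,2) by (intro mult_left_mono vector_mult_mono) auto
  also have "\<dots> \<le> ?y v"
    using exc[OF i(1)] i(2) v by (simp add: excessive_def)
  finally show "a * vector_mult ?y v \<le> ?y v" .
qed

lemma excessive_normalize_on: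
  assumes "excessive a x"
  shows "excessive a (normalize_on V x)"
proof -
  define s where "s = (\<Sum>w\<in>V. \<bar>x w\<bar>)"
  have "0 \<le> s"
    by (simp add: s_def sum_nonneg)
  have "vector_mult (normalize_on V x) v = vector_mult x v / s" for v
    unfolding vector_mult_divide[symmetric]
    by (rule vector_mult_cong) (simp add: normalize_on_def s_def)
  then show ?thesis
    using assms \<open>0 \<le> s\<close> divide_right_mono[of "a * vector_mult x _" "x _" s]
    by (simp add: excessive_def normalize_on_def s_def)
qed

lemma excessive_pos_step:
  assumes "0 < a" and exc: "excessive a x" and "u \<in> V" "v \<in> V" "0 < x u" "0 < M u v"
  shows "0 < x v"
proof -
  have "0 < x u * M u v"
    using assms by simp
  also have "\<dots> \<le> vector_mult x v"
    using assms excessive_nonneg[OF exc] by (intro vector_mult_ge_entry)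
  finally have "0 < a * vector_mult x v"
    using assms(1) by simp
  also have "\<dots> \<le> x v"
    using exc \<open>v \<in> V\<close> by (simp add: excessive_def)
  finally show ?thesis .
qed

lemma excessive_iff_ex_stationary_teleport:
  assumes "0 < \<epsilon>" and dist: "distribution_on V x"
  shows "excessive (1 - \<epsilon>) x \<longleftrightarrow>
    (\<exists>r. distribution_on V r \<and> stationary_distribution V (teleport_matrix M r \<epsilon>) x)"
proof
  assume exc: "excessive (1 - \<epsilon>) x"
  define r where "r = (\<lambda>v\<in>V. (x v - (1 - \<epsilon>) * vector_mult x v) / \<epsilon>)"
  have fixpoint: "discounted_fixpoint (1 - \<epsilon>) (\<lambda>v. \<epsilon> * r v) x"
    using assms(1) by (simp add: discounted_fixpoint_def r_def)
  have "(\<Sum>v\<in>V. r v) = 1"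
    using discounted_fixpoint_sum[OF fixpoint] dist assms(1)
    by (simp add: distribution_on_def sum_distrib_left[symmetric])
  moreover have "0 \<le> r v" if "v \<in> V" for v
    using exc that assms(1) by (simp add: r_def excessive_def)
  ultimately have "distribution_on V r"
    by (simp add: distribution_on_iff finite_index r_def)
  with fixpoint dist show
    "\<exists>r. distribution_on V r \<and> stationary_distribution V (teleport_matrix M r \<epsilon>) x"
    by (auto simp: stationary_teleport_iff)
next
  assume "\<exists>r. distribution_on V r \<and> stationary_distribution V (teleport_matrix M r \<epsilon>) x"
  then obtain r where r_nonneg: "\<And>v. v \<in> V \<Longrightarrow> 0 \<le> r v"
    and fixpoint: "discounted_fixpoint (1 - \<epsilon>) (\<lambda>v. \<epsilon> * r v) x"
    by (auto simp: stationary_teleport_iff distribution_on_iff finite_index)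
  have "(1 - \<epsilon>) * vector_mult x v \<le> x v" if "v \<in> V" for v
  proof -
    have "0 \<le> \<epsilon> * r v"
      using r_nonneg[OF that] assms(1) by simp
    moreover have "x v = (1 - \<epsilon>) * vector_mult x v + \<epsilon> * r v"
      using fixpoint that by (simp add: discounted_fixpoint_def)
    ultimately show ?thesis
      by linarith
  qed
  with dist show "excessive (1 - \<epsilon>) x"
    by (simp add: excessive_def distribution_on_iff finite_index)
qed

end

section \<open>PageRank vectors\<close>

locale sinkless_digraph = pair_fin_digraph G for G :: "'a pair_pre_digraph" +
  assumes out_degree_pos: "\<And>u. u \<in> pverts G \<Longrightarrow> 0 < out_degree (with_proj G) u"
begin

lemma walk_matrix_pos:
  assumes "(u, v) \<in> parcs G"
  shows "0 < walk_matrix G u v"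
  using assms out_degree_pos in_arcsD1 by (simp add: walk_matrix_def)

lemma walk_matrix_row_sum:
  assumes "u \<in> pverts G"
  shows "(\<Sum>v\<in>pverts G. walk_matrix G u v) = 1"
proof -
  let ?N = "{v \<in> pverts G. (u, v) \<in> parcs G}"
  have "out_arcs (with_proj G) u = Pair u ` ?N"
    using in_arcsD2 by (auto simp: out_arcs_def)
  then have deg: "out_degree (with_proj G) u = card ?N"
    by (simp add: out_degree_def card_image inj_on_def)
  have "(\<Sum>v\<in>pverts G. walk_matrix G u v) = (\<Sum>v\<in>?N. 1 / real (out_degree (with_proj G) u))"
    unfolding walk_matrix_def by (rule sum.inter_filter[symmetric]) simp
  also have "\<dots> = 1"
    using out_degree_pos[OF assms] by (simp add: deg card_gt_0_iff)
  finally show ?thesis .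
qed

sublocale stochastic_matrix "pverts G" "walk_matrix G"
  by unfold_locales (simp_all add: walk_matrix_row_sum, simp add: walk_matrix_def)

lemma ranking_vector_point_mass:
  assumes "c \<in> pverts G"
  shows "ranking_vector G (point_mass G c)"
  using assms by (simp add: distribution_on_iff point_mass_def)

lemma PR_eq_iff_stationary:
  assumes "0 < \<epsilon>" "\<epsilon> \<le> 1" "ranking_vector G r"
  shows "PR G r \<epsilon> = x \<longleftrightarrow>
    stationary_distribution (pverts G) (teleport_matrix (walk_matrix G) r \<epsilon>) x"
proof -
  let ?stat = "stationary_distribution (pverts G) (teleport_matrix (walk_matrix G) r \<epsilon>)"
  have "\<exists>!x. ?stat x"
    using ex_stationary_teleport[OF assms] stationary_teleport_unique[OF assms(1,2)]
    by (rule ex_ex1I)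
  then show ?thesis
    unfolding PR_def teleport_matrix_def[symmetric] by (metis theI')
qed

lemma stationary_PR:
  assumes "0 < \<epsilon>" "\<epsilon> \<le> 1" "ranking_vector G r"
  shows "stationary_distribution (pverts G) (teleport_matrix (walk_matrix G) r \<epsilon>) (PR G r \<epsilon>)"
  using PR_eq_iff_stationary[OF assms] by blast

lemma excessive_iff_ex_PR_eq:
  assumes "0 < \<epsilon>" "\<epsilon> \<le> 1" "ranking_vector G x"
  shows "excessive (1 - \<epsilon>) x \<longleftrightarrow> (\<exists>r. ranking_vector G r \<and> PR G r \<epsilon> = x)"
  unfolding excessive_iff_ex_stationary_teleport[OF assms(1,3)]
  using PR_eq_iff_stationary[OF assms(1,2)] by auto

lemma excessive_PR:
  assumes "0 < \<epsilon>" "\<epsilon> \<le> 1" "ranking_vector G r"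
  shows "excessive (1 - \<epsilon>) (PR G r \<epsilon>)"
proof -
  have "ranking_vector G (PR G r \<epsilon>)"
    using stationary_PR[OF assms] by (simp add: stationary_distribution_def)
  then show ?thesis
    using excessive_iff_ex_PR_eq[OF assms(1,2)] assms(3) by blast
qed

lemma PR_ge_reset:
  assumes "0 < \<epsilon>" "\<epsilon> \<le> 1" "ranking_vector G r" "v \<in> pverts G"
  shows "\<epsilon> * r v \<le> PR G r \<epsilon> v"
proof -
  have "0 \<le> (1 - \<epsilon>) * vector_mult (PR G r \<epsilon>) v"
    using assms excessive_nonneg[OF excessive_PR[OF assms(1-3)]]
    by (intro mult_nonneg_nonneg vector_mult_nonneg) auto
  moreover have "PR G r \<epsilon> v = (1 - \<epsilon>) * vector_mult (PR G r \<epsilon>) v + \<epsilon> * r v"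
    using stationary_PR[OF assms(1-3)] assms(4)
    by (simp add: stationary_teleport_iff discounted_fixpoint_def)
  ultimately show ?thesis
    by linarith
qed

lemma excessive_pos_reachable:
  assumes "0 < a" "excessive a x" "0 < x u" and "reachable (with_proj G) u v"
  shows "0 < x v"
  using assms(4)
proof (induction rule: reachable_induct)
  case base
  show ?case by fact
next
  case (step w v)
  then have "(w, v) \<in> parcs G"
    by auto
  then show ?case
    using excessive_pos_step[OF assms(1,2) _ _ step.IH walk_matrix_pos] in_arcsD1 in_arcsD2
    by blast
qed

lemma PR_point_mass_pos:
  assumes "0 < \<epsilon>" "\<epsilon> < 1" "c \<in> pverts G" and "reachable (with_proj G) c v"
  shows "0 < PR G (point_mass G c) \<epsilon> v"
proof (rule excessive_pos_reachable)
  have rank: "ranking_vector G (point_mass G c)"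
    using assms(3) by (rule ranking_vector_point_mass)
  then show "excessive (1 - \<epsilon>) (PR G (point_mass G c) \<epsilon>)"
    using assms by (simp add: excessive_PR)
  show "0 < PR G (point_mass G c) \<epsilon> c"
    using PR_ge_reset[OF assms(1) _ rank assms(3)] assms(1-3) by (simp add: point_mass_def)
qed (use assms in auto)

end

theorem theorem8:
  fixes G :: "'a pair_pre_digraph" and K :: "'a set" and \<epsilon> :: real
  assumes "pair_fin_digraph G"
    and "\<And>u. u \<in> pverts G \<Longrightarrow> out_degree (with_proj G) u > 0"
    and "0 < \<epsilon>" and "\<epsilon> < 1"
    and "coherent G K"
  shows "\<exists>r. ranking_vector G r \<and> R_min G K \<epsilon> = PR G r \<epsilon>"
proof -
  interpret sinkless_digraph G
    using assms(1,2) by (intro sinkless_digraph.intro sinkless_digraph_axioms.intro)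
  define y where "y = (\<lambda>v. Min ((\<lambda>c. PR G (point_mass G c) \<epsilon> v) ` K))"
  obtain t where t: "t \<in> pverts G" and reach: "\<And>c. c \<in> K \<Longrightarrow> reachable (with_proj G) c t"
    and seeds: "K \<noteq> {}" "K \<subseteq> pverts G" "finite K"
    using assms(5) finite_subset[of K "pverts G"] by (auto simp: coherent_def)
  have exc: "excessive (1 - \<epsilon>) y"
    unfolding y_def using seeds assms(3,4)
    by (intro excessive_Min excessive_PR ranking_vector_point_mass) auto
  have "0 < y t"
    using seeds reach PR_point_mass_pos[OF assms(3,4)] by (auto simp: y_def)
  then have "ranking_vector G (normalize_on (pverts G) y)"
    using t excessive_nonneg[OF exc] by (intro distribution_on_normalize_on) auto
  then obtain r where "ranking_vector G r" "PR G r \<epsilon> = normalize_on (pverts G) y"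
    using excessive_iff_ex_PR_eq[OF assms(3)] excessive_normalize_on[OF exc] assms(4) by force
  moreover have "R_min G K \<epsilon> = normalize_on (pverts G) y"
    by (simp add: R_min_def normalize_on_def y_def)
  ultimately show ?thesis
    by auto
qed

end
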